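(* There exist absolute constants $0<c\le C<\infty$ (independent of the lattice) such that for every lattice $\mathcal{L}$ and every $\mathfrak{A}_\infty$-measurable $f\in L^1(\mathbb{R})$, $$c\,\|Sf\|_{L^1}\le \|Mf\|_{L^1}\le C\,\|Sf\|_{L^1}$$ (both sides possibly infinite). In other words the martingale Hardy spaces $H^1_*$ and $H^1_S$ coincide with equivalent norms.
   Context: Work on $\mathbb{R}$ with Lebesgue measure; $|I|$ denotes length. A lattice $\mathcal{L}$ is a collection of nondegenerate finite intervals of $\mathbb{R}$ which is a union of generations $\mathcal{L}_k$, $k\in\mathbb{Z}$, where each $\mathcal{L}_k$ is a collection of pairwise disjoint intervals covering $\mathbb{R}$, and for each $k$ every $I\in\mathcal{L}_k$ is a finite disjoint union of intervals of $\mathcal{L}_{k+1}$ (possibly of $I$ alone). For $I\in\mathcal{L}$, $\mathrm{rk}(I)$ is the largest $k$ with $I\in\mathcal{L}_k$; if $\mathrm{rk}(I)=k$, $\mathrm{child}(I)$ is the set of $J\in\mathcal{L}_{k+1}$ with $J\subseteq I$. A function is $\mathfrak{A}_\infty$-measurable if it is Borel measurable and constant on every set $\bigcap_{k}I_k$ with $I_k\in\mathcal{L}_k$, $I_k\subseteq I_{k-1}$. $\mathfrak{A}_{-\infty}^{0,\mathrm{fin}}$ is the collection of sets $\bigcup_kI_k$ ($I_k\in\mathcal{L}_k$, $I_k\subseteq I_{k-1}$) of finite measure. $\langle f\rangle_I=\frac1{|I|}\int_If$, $\mathbb{E}_If=\langle f\rangle_I\mathbf{1}_I$, and for $I\in\mathcal{L}$,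 $\Delta_If=-\mathbb{E}_If+\sum_{J\in\mathrm{child}(I)}\mathbb{E}_Jf$. The maximal function is $Mf(x)=\sup_{I\in\mathcal{L},\,x\in I}|\langle f\rangle_I|$ and the square function is $Sf(x)=\big[\sum_{I\in\mathcal{L}}|\Delta_If(x)|^2+\sum_{I\in\mathfrak{A}_{-\infty}^{0,\mathrm{fin}}}|\mathbb{E}_If(x)|^2\big]^{1/2}$. $H^1_*=\{f: Mf\in L^1\}$ with norm $\|Mf\|_1$, $H^1_S=\{f:Sf\in L^1\}$ with norm $\|Sf\|_1$. *)

theory Defs
  imports "HOL-Analysis.Analysis"
begin

definition nd_interval :: "real set \<Rightarrow> bool" where
  "nd_interval I \<longleftrightarrow> (\<exists>a b. a < b \<and> {a<..<b} \<subseteq> I \<and> I \<subseteq> {a..b})"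

definition lattice :: "(int \<Rightarrow> real set set) \<Rightarrow> bool" where
  "lattice L \<longleftrightarrow> (\<forall>k.
      (\<forall>I\<in>L k. nd_interval I) \<and> disjoint (L k) \<and> \<Union>(L k) = UNIV \<and>
      (\<forall>I\<in>L k. \<exists>F. finite F \<and> F \<subseteq> L (k + 1) \<and> disjoint F \<and> \<Union>F = I))"

definition lat_set :: "(int \<Rightarrow> real set set) \<Rightarrow> real set set" where
  "lat_set L = \<Union>(range L)"

definition has_rank :: "(int \<Rightarrow> real set set) \<Rightarrow> real set \<Rightarrow> bool" where
  "has_rank L I \<longleftrightarrow> (\<exists>k. I \<in> L k \<and> (\<forall>k'. I \<in> L k' \<longrightarrow> k' \<le> k))"

definition rk :: "(int \<Rightarrow> real set set) \<Rightarrow> real set \<Rightarrow> int" where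
  "rk L I = (GREATEST k. I \<in> L k)"

definition child :: "(int \<Rightarrow> real set set) \<Rightarrow> real set \<Rightarrow> real set set" where
  "child L I = {J \<in> L (rk L I + 1). J \<subseteq> I}"

definition lat_chain :: "(int \<Rightarrow> real set set) \<Rightarrow> (int \<Rightarrow> real set) \<Rightarrow> bool" where
  "lat_chain L I \<longleftrightarrow> (\<forall>k. I k \<in> L k \<and> I k \<subseteq> I (k - 1))"

definition A_inf_measurable :: "(int \<Rightarrow> real set set) \<Rightarrow> (real \<Rightarrow> real) \<Rightarrow> bool" where
  "A_inf_measurable L f \<longleftrightarrow> f \<in> borel_measurable borel \<and>
     (\<forall>I. lat_chain L I \<longrightarrow> (\<forall>x\<in>\<Inter>(range I). \<forall>y\<in>\<Inter>(range I). f x = f y))"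

definition A_minf_fin :: "(int \<Rightarrow> real set set) \<Rightarrow> real set set" where
  "A_minf_fin L = {A. \<exists>I. lat_chain L I \<and> A = \<Union>(range I) \<and> emeasure lborel A < \<infinity>}"

definition avg :: "(real \<Rightarrow> real) \<Rightarrow> real set \<Rightarrow> real" where
  "avg f I = (LINT y:I|lborel. f y) / measure lborel I"

definition Ecx :: "(real \<Rightarrow> real) \<Rightarrow> real set \<Rightarrow> real \<Rightarrow> real" where
  "Ecx f I x = indicator I x * avg f I"

text \<open>Martingale difference; set to 0 for intervals without a (finite) rank,
  where the children would consist of I alone.\<close>
definition Delta :: "(int \<Rightarrow> real set set) \<Rightarrow> (real \<Rightarrow> real) \<Rightarrow> real set \<Rightarrow> real \<Rightarrow> real" where
  "Delta L f I x = (if has_rank L I then - Ecx f I x + (\<Sum>J\<in>child L I. Ecx f J x) else 0)"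

definition maxf :: "(int \<Rightarrow> real set set) \<Rightarrow> (real \<Rightarrow> real) \<Rightarrow> real \<Rightarrow> ennreal" where
  "maxf L f x = (SUP I \<in> {I \<in> lat_set L. x \<in> I}. ennreal \<bar>avg f I\<bar>)"

definition sqrt_enn :: "ennreal \<Rightarrow> ennreal" where
  "sqrt_enn a = (if a = \<infinity> then \<infinity> else ennreal (sqrt (enn2real a)))"

definition sqf :: "(int \<Rightarrow> real set set) \<Rightarrow> (real \<Rightarrow> real) \<Rightarrow> real \<Rightarrow> ennreal" where
  "sqf L f x = sqrt_enn ((\<Sum>\<^sub>\<infinity>I\<in>lat_set L. ennreal ((Delta L f I x)\<^sup>2))
                        + (\<Sum>\<^sub>\<infinity>A\<in>A_minf_fin L. ennreal ((Ecx f A x)\<^sup>2)))"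

end

theory Submission
  imports Defs
begin

text \<open>
  The averages of \<open>f\<close> over the intervals of generation \<open>k\<close> form a martingale indexed by the integers
  and the claim is Davis' inequality for it. We follow the pathwise approach of Beiglboeck and
  Siorpaes: for every real sequence \<open>X\<close> with \<open>X 0 = 0\<close>, running maximum \<open>m\<close>, quadratic variation \<open>q\<close>
  and \<open>H n = (\<Sum>i<n. X i / sqrt (q i + (m i)\<^sup>2) * (X (Suc i) - X i))\<close> one has
  \<open>sqrt (q n) \<le> 4 * m n - H n\<close> and \<open>m n \<le> 12 * sqrt (q n) + 2 * H n\<close>. If \<open>X\<close> is a martingale, then \<open>H\<close>
  is a martingale transform and integrates to \<open>0\<close> over every cell of the initial generation, so
  integration gives both inequalities on a finite time interval, with constants independent of the lattice.
  Starting \<open>X\<close> at \<open>0\<close>, that is, subtracting the martingale at the initial time \<open>-n\<close>,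
  lets the initial time tend to \<open>-\<infinity>\<close>: monotone convergence handles the square
  function and Fatou's lemma the maximal function.
\<close>

section \<open>Pathwise Davis inequalities\<close>

text \<open>Concavity of the square root: its graph lies below the tangent at
  \<open>w\<^sup>2\<close>.\<close>

lemma le_tangent_of_square:
  fixes v w r :: real
  assumes w: "0 < w" and v: "v\<^sup>2 = w\<^sup>2 + r"
  shows "v \<le> w + r / (2 * w)"
proof -
  have "0 \<le> (v - w)\<^sup>2" by simp
  then have "2 * w * v \<le> 2 * w\<^sup>2 + r" using v by (simp add: power2_eq_square algebra_simps)
  then show ?thesis using w by (simp add: field_simps power2_eq_square)
qed

text \<open>
  As \<open>2 * x * d = ((x + d)\<^sup>2 - x\<^sup>2) - d\<^sup>2\<close>, the term \<open>x / w * d\<close> is the increment of \<open>x\<^sup>2\<close> minus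
  that of \<open>q\<close>, divided by \<open>2 * w\<close>; this suggests the terms \<open>x\<^sup>2 / (2 * w)\<close> and \<open>w\<close> of the
  potentials below. Replacing \<open>x\<^sup>2\<close> by \<open>x\<^sup>2 - m\<^sup>2\<close> makes the first one vanish whenever \<open>\<bar>x\<bar>\<close> reaches
  a new maximum, where \<open>w\<close> may jump; there large and small \<open>d\<close> need separate estimates.
\<close>

lemma square_function_step:
  fixes x d m q :: real
  assumes xm: "\<bar>x\<bar> \<le> m" and q: "0 \<le> q"
    and w_def: "w = sqrt (q + m\<^sup>2)"
    and m'_def: "m' = max m \<bar>x + d\<bar>"
    and w'_def: "w' = sqrt (q + d\<^sup>2 + m'\<^sup>2)"
  shows "w' + (m'\<^sup>2 - (x + d)\<^sup>2) / (2 * w') - 4 * m' + x / w * d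
    \<le> w + (m\<^sup>2 - x\<^sup>2) / (2 * w) - 4 * m"
proof -
  have m0: "0 \<le> m" and m'm: "m \<le> m'" using xm m'_def by auto
  have w2: "w\<^sup>2 = q + m\<^sup>2" and w0: "0 \<le> w" using q w_def by auto
  have w'2: "w'\<^sup>2 = q + d\<^sup>2 + m'\<^sup>2" and w'0: "0 \<le> w'" using q w'_def by auto
  have mw: "m \<le> w" using w2 w0 q m0 by - (rule power2_le_imp_le, auto)
  have mm'2: "m\<^sup>2 \<le> m'\<^sup>2" using m0 m'm by (intro power_mono) auto
  have ww': "w \<le> w'" using w2 w'2 w'0 mm'2 by - (rule power2_le_imp_le, simp_all add: add_increasing)
  show ?thesis
  proof (cases "w = 0")
    \<comment> \<open>Here \<open>m\<close>, \<open>q\<close> and \<open>x\<close> vanish,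
      \<open>x / w\<close> is 0 by the convention for division by zero, and \<open>w'\<close> is
      \<open>sqrt 2 * \<bar>d\<bar>\<close>.\<close>
    case True
    then have "m = 0" "q = 0" "x = 0" using mw m0 w2 xm by auto
    then have "m' = \<bar>d\<bar>" "w'\<^sup>2 = 2 * d\<^sup>2" using m'_def w'2 by auto
    moreover have "w' \<le> 2 * \<bar>d\<bar>"
      using \<open>w'\<^sup>2 = 2 * d\<^sup>2\<close> by - (rule power2_le_imp_le, auto simp: power_mult_distrib)
    ultimately show ?thesis using \<open>m = 0\<close> \<open>x = 0\<close> True by simp
  next
    case False
    then have wp: "0 < w" using w0 by simp
    have quad: "w' \<le> w + (d\<^sup>2 + m'\<^sup>2 - m\<^sup>2) / (2 * w)"
      using le_tangent_of_square[OF wp, of w' "d\<^sup>2 + m'\<^sup>2 - m\<^sup>2"] w2 w'2 by simp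
    show ?thesis
    proof (cases "\<bar>x + d\<bar> \<le> m")
      \<comment> \<open>No new maximum: once \<open>w'\<close> is replaced by \<open>w\<close> in
        the denominator, the tangent bound \<open>quad\<close> and the identity below balance
        exactly.\<close>
      case True
      then have m': "m' = m" using m'_def by simp
      have "(x + d)\<^sup>2 \<le> m\<^sup>2" using True by (metis abs_ge_zero power2_abs power_mono)
      then have "(m\<^sup>2 - (x + d)\<^sup>2) / (2 * w') \<le> (m\<^sup>2 - (x + d)\<^sup>2) / (2 * w)"
        using ww' wp by (intro divide_left_mono) auto
      moreover have "d\<^sup>2 / (2 * w) + (m\<^sup>2 - (x + d)\<^sup>2) / (2 * w) + x / w * d = (m\<^sup>2 - x\<^sup>2) / (2 * w)"
        using wp by (simp add: field_simps power2_eq_square)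
      ultimately show ?thesis using quad m' by simp
    next
      case False
      then have m': "m' = \<bar>x + d\<bar>" and lt: "m < m'" using m'_def by auto
      have m'2: "m'\<^sup>2 = (x + d)\<^sup>2" using m' by simp
      have eq: "x / w * d - (m\<^sup>2 - x\<^sup>2) / (2 * w) = (m'\<^sup>2 - m\<^sup>2 - d\<^sup>2) / (2 * w)"
        using wp m'2 by (simp add: field_simps power2_eq_square)
      have "w' - w + (m'\<^sup>2 - m\<^sup>2 - d\<^sup>2) / (2 * w) \<le> 4 * (m' - m)"
      \<comment> \<open>Both cases lead to the constant 4. For a moderate jump
        \<open>m' + m \<le> 4 * w\<close>; for a large one \<open>w'\<close> grows by at most
        \<open>3 * (m' - m)\<close> and the quotient adds at most \<open>m' - m\<close>.\<close>
      proof (cases "m' \<le> 3 * m")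
        case True
        have "(m' - m) * (m' + m) / w
            = (d\<^sup>2 + m'\<^sup>2 - m\<^sup>2) / (2 * w) + (m'\<^sup>2 - m\<^sup>2 - d\<^sup>2) / (2 * w)"
          using wp by (simp add: field_simps power2_eq_square)
        then have "w' - w + (m'\<^sup>2 - m\<^sup>2 - d\<^sup>2) / (2 * w) \<le> (m' - m) * (m' + m) / w"
          using quad by linarith
        also have "\<dots> \<le> (m' - m) * (4 * w) / w"
          using True mw lt wp by (intro divide_right_mono mult_left_mono) auto
        finally show ?thesis using wp by simp
      next
        case False
        have "\<bar>d\<bar> \<ge> m' - m" "\<bar>d\<bar> \<le> m' + m" using m' xm by auto
        then have d1: "(m' - m)\<^sup>2 \<le> d\<^sup>2" and d2: "d\<^sup>2 \<le> (m' + m)\<^sup>2"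
          using lt m0 by (metis abs_ge_zero diff_ge_0_iff_ge less_imp_le power2_abs power_mono)+
        have "m'\<^sup>2 - m\<^sup>2 - d\<^sup>2 \<le> 2 * m * (m' - m)"
          using d1 by (simp add: power2_eq_square algebra_simps)
        also have "\<dots> \<le> 2 * w * (m' - m)" using mw lt by (intro mult_right_mono) auto
        finally have A: "(m'\<^sup>2 - m\<^sup>2 - d\<^sup>2) / (2 * w) \<le> m' - m"
          using wp by (simp add: field_simps)
        have r0: "0 \<le> 3 * (m' - m)" using lt by simp
        \<comment> \<open>This is what bounding
          \<open>(m' + m)\<^sup>2 + m'\<^sup>2 - m\<^sup>2\<close> by
          \<open>9 * (m' - m)\<^sup>2\<close> amounts to, up to the term
          \<open>9 * m\<^sup>2\<close>.\<close>
        have "m' * (20 * m) \<le> m' * (7 * m')" using False lt m0 by (intro mult_left_mono) auto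
        then have "m' * (20 * m) \<le> 9 * (m * m) + m' * (7 * m')" by (simp add: add_increasing)
        then have "d\<^sup>2 + m'\<^sup>2 - m\<^sup>2 \<le> (3 * (m' - m))\<^sup>2"
          using d2 by (simp add: power2_eq_square algebra_simps)
        then have "w'\<^sup>2 \<le> w\<^sup>2 + (3 * (m' - m))\<^sup>2" using w2 w'2 by simp
        also have "\<dots> \<le> (w + 3 * (m' - m))\<^sup>2" using w0 r0 by (simp add: power2_sum)
        finally have "w' \<le> w + 3 * (m' - m)" using w0 r0 by - (rule power2_le_imp_le, auto)
        then show ?thesis using A by simp
      qed
      then show ?thesis using eq m'2 by simp
    qed
  qed
qed

text \<open>The transform now enters with the opposite sign, and the growth of
  \<open>sqrt q\<close>, not that of the maximum, has to pay for each step. The fraction therefore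
  changes sign in the potential; it still vanishes when \<open>\<bar>x\<bar>\<close> reaches a new
  maximum.\<close>

lemma maximal_function_step:
  fixes x d m q :: real
  assumes xm: "\<bar>x\<bar> \<le> m" and q: "0 \<le> q"
    and w_def: "w = sqrt (q + m\<^sup>2)"
    and m'_def: "m' = max m \<bar>x + d\<bar>"
    and w'_def: "w' = sqrt (q + d\<^sup>2 + m'\<^sup>2)"
  shows "((x + d)\<^sup>2 - m'\<^sup>2) / (2 * w') + w' - 6 * sqrt (q + d\<^sup>2)
    \<le> (x\<^sup>2 - m\<^sup>2) / (2 * w) + w - 6 * sqrt q + x / w * d"
proof -
  define s s' where "s = sqrt q" and "s' = sqrt (q + d\<^sup>2)"
  have m0: "0 \<le> m" and m'm: "m \<le> m'" using xm m'_def by auto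
  have w2: "w\<^sup>2 = q + m\<^sup>2" and w0: "0 \<le> w" using q w_def by auto
  have w'2: "w'\<^sup>2 = q + d\<^sup>2 + m'\<^sup>2" and w'0: "0 \<le> w'" using q w'_def by auto
  have s2: "s\<^sup>2 = q" and s0: "0 \<le> s" using q s_def by auto
  have s'2: "s'\<^sup>2 = q + d\<^sup>2" and s'0: "0 \<le> s'" using q s'_def by auto
  have mw: "m \<le> w" using w2 w0 q m0 by - (rule power2_le_imp_le, auto)
  have sw: "s \<le> w" using w2 w0 s2 by - (rule power2_le_imp_le, auto)
  have sw': "s' \<le> w'" using w'2 w'0 s'2 by - (rule power2_le_imp_le, auto)
  have ss': "s \<le> s'" using s2 s'2 s'0 by - (rule power2_le_imp_le, auto)
  have ds': "\<bar>d\<bar> \<le> s'" using s'2 s'0 q by - (rule power2_le_imp_le, auto)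
  have s'd: "s' \<le> s + \<bar>d\<bar>" using s'2 s2 s0
    by - (rule power2_le_imp_le, auto simp: power2_sum)
  have mm'2: "m\<^sup>2 \<le> m'\<^sup>2" using m0 m'm by (intro power_mono) auto
  have ww': "w \<le> w'" using w2 w'2 w'0 mm'2 by - (rule power2_le_imp_le, simp_all add: add_increasing)
  have dd: "d\<^sup>2 = (s' - s) * (s' + s)" using s2 s'2 by (simp add: power2_eq_square algebra_simps)
  show ?thesis
  proof (cases "w = 0")
    case True
    then have *: "m = 0" "q = 0" "x = 0" using mw m0 w2 xm by auto
    then have "m' = \<bar>d\<bar>" "w'\<^sup>2 = 2 * d\<^sup>2" using m'_def w'2 by auto
    moreover have "w' \<le> 2 * \<bar>d\<bar>"
      using \<open>w'\<^sup>2 = 2 * d\<^sup>2\<close> by - (rule power2_le_imp_le, auto simp: power_mult_distrib)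
    ultimately show ?thesis using * True by simp
  next
    case False
    then have wp: "0 < w" using w0 by simp
    have quad: "w' \<le> w + (d\<^sup>2 + m'\<^sup>2 - m\<^sup>2) / (2 * w)"
      using le_tangent_of_square[OF wp, of w' "d\<^sup>2 + m'\<^sup>2 - m\<^sup>2"] w2 w'2 by simp
    show ?thesis
    proof (cases "\<bar>x + d\<bar> \<le> m")
      case True
      \<comment> \<open>Without a new maximum the costs \<open>T\<close>, \<open>W\<close> and
        \<open>D\<close> are at most 1/2, 1 and 2 times \<open>s' - s\<close>, which stays below
        6.\<close>
      then have m': "m' = m" using m'_def by simp
      define t where "t = m\<^sup>2 - (x + d)\<^sup>2"
      have "(x + d)\<^sup>2 \<le> m\<^sup>2" using True by (metis abs_ge_zero power2_abs power_mono)
      then have t0: "0 \<le> t" by (simp add: t_def)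
      have "t \<le> w\<^sup>2" unfolding t_def using w2 q zero_le_power2[of "x + d"] by linarith
      also have "\<dots> \<le> w * w'" using ww' w0 by (simp add: power2_eq_square mult_left_mono)
      finally have tw: "t \<le> w * w'" .
      have w'p: "0 < w'" using wp ww' by simp
      have "t * (w' - w) \<le> w * w' * (w' - w)" using tw ww' by (intro mult_right_mono) auto
      then have T: "t / (2 * w) - t / (2 * w') \<le> (w' - w) / 2"
        using wp w'p by (simp add: field_simps)
      \<comment> \<open>The difference of \<open>w\<^sup>2\<close> and \<open>s\<^sup>2\<close>
        keeps the value \<open>m\<^sup>2\<close>, so the larger root grows more slowly.\<close>
      have W: "w' - w \<le> s' - s"
      proof -
        have "(w' - w) * (w' + w) = (s' - s) * (s' + s)"
          using w2 w'2 dd m' by (simp add: power2_eq_square algebra_simps)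
        also have "\<dots> \<le> (s' - s) * (w' + w)" using sw sw' ss' by (intro mult_left_mono) auto
        finally show ?thesis using wp w'p by simp
      qed
      have "\<bar>d\<bar> \<le> 2 * w" using True xm mw by linarith
      then have "(s' - s) * (s' + s) \<le> (s' - s) * (4 * w)"
        using s'd sw ss' by (intro mult_left_mono) auto
      then have D: "d\<^sup>2 / (2 * w) \<le> 2 * (s' - s)" using wp dd by (simp add: field_simps)
      have E: "(x\<^sup>2 - m\<^sup>2) / (2 * w) + x / w * d = - (t / (2 * w)) - d\<^sup>2 / (2 * w)"
        using wp by (simp add: field_simps power2_eq_square t_def)
      have "((x + d)\<^sup>2 - m\<^sup>2) / (2 * w') = - (t / (2 * w'))"
        by (simp add: t_def diff_divide_distrib)
      then show ?thesis using T W D E ss' m' unfolding s_def[symmetric] s'_def[symmetric]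
        by simp
    next
      case False
      then have m': "m' = \<bar>x + d\<bar>" and lt: "m < m'" using m'_def by auto
      have m'2: "m'\<^sup>2 = (x + d)\<^sup>2" using m' by simp
      have eq: "x / w * d + (x\<^sup>2 - m\<^sup>2) / (2 * w) = - ((d\<^sup>2 - m'\<^sup>2 + m\<^sup>2) / (2 * w))"
        using wp m'2 by (simp add: field_simps power2_eq_square)
      have "w' - w + (d\<^sup>2 - m'\<^sup>2 + m\<^sup>2) / (2 * w) \<le> 6 * (s' - s)"
      \<comment> \<open>The constant 6 comes from
        \<open>s' + s \<le> 2 * w + \<bar>d\<bar> \<le> 6 * w\<close> for small \<open>d\<close>.
        For large \<open>d\<close> both terms on the left are at most
        \<open>2 * \<bar>d\<bar>\<close>, while \<open>6 * (s' - s)\<close> is at least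
        \<open>9 / 2 * \<bar>d\<bar>\<close>.\<close>
      proof (cases "\<bar>d\<bar> \<le> 4 * w")
        case True
        have "(s' - s) * (s' + s) / w
            = (d\<^sup>2 + m'\<^sup>2 - m\<^sup>2) / (2 * w) + (d\<^sup>2 - m'\<^sup>2 + m\<^sup>2) / (2 * w)"
          unfolding dd[symmetric] using wp by (simp add: field_simps)
        then have "w' - w + (d\<^sup>2 - m'\<^sup>2 + m\<^sup>2) / (2 * w) \<le> (s' - s) * (s' + s) / w"
          using quad by linarith
        also have "\<dots> \<le> (s' - s) * (6 * w) / w"
          using True s'd sw ss' wp by (intro divide_right_mono mult_left_mono) auto
        finally show ?thesis using wp by simp
      next
        case False
        have 1: "s' - s \<ge> 3 / 4 * \<bar>d\<bar>" using ds' sw False by simp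
        have md: "4 * m \<le> \<bar>d\<bar>" using mw False by simp
        have "m' \<le> m + \<bar>d\<bar>" using m' xm by auto
        then have "m'\<^sup>2 \<le> (m + \<bar>d\<bar>)\<^sup>2" using lt m0 by (intro power_mono) auto
        moreover have "m * \<bar>d\<bar> \<le> \<bar>d\<bar> * \<bar>d\<bar>" using md m0 by (intro mult_right_mono) auto
        ultimately have "d\<^sup>2 + m'\<^sup>2 - m\<^sup>2 \<le> 4 * d\<^sup>2"
          by (simp add: power2_eq_square algebra_simps)
        then have "w'\<^sup>2 \<le> w\<^sup>2 + (2 * \<bar>d\<bar>)\<^sup>2" using w2 w'2 by (simp add: power_mult_distrib)
        also have "\<dots> \<le> (w + 2 * \<bar>d\<bar>)\<^sup>2" using w0 by (simp add: power2_sum)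
        finally have 2: "w' \<le> w + 2 * \<bar>d\<bar>" using w0 by - (rule power2_le_imp_le, auto)
        \<comment> \<open>Since \<open>\<bar>x + d\<bar>\<close> exceeds \<open>m\<close>, the gap
          \<open>m - \<bar>x\<bar>\<close> is smaller than \<open>\<bar>d\<bar>\<close>.\<close>
        have "m\<^sup>2 - x\<^sup>2 = (m - \<bar>x\<bar>) * (m + \<bar>x\<bar>)" by (simp add: power2_eq_square algebra_simps)
        also have "\<dots> \<le> \<bar>d\<bar> * (2 * w)" using m' lt xm mw m0 by (intro mult_mono) auto
        finally have a: "m\<^sup>2 - x\<^sup>2 \<le> \<bar>d\<bar> * (2 * w)" .
        have "- (x * d) \<le> \<bar>x\<bar> * \<bar>d\<bar>" by (simp add: abs_mult[symmetric])
        also have "\<dots> \<le> w * \<bar>d\<bar>" using xm mw by (intro mult_right_mono) auto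
        finally have "d\<^sup>2 - m'\<^sup>2 + m\<^sup>2 \<le> 4 * w * \<bar>d\<bar>"
          using a m'2 by (simp add: power2_eq_square algebra_simps)
        then have "(d\<^sup>2 - m'\<^sup>2 + m\<^sup>2) / (2 * w) \<le> 2 * \<bar>d\<bar>" using wp by (simp add: field_simps)
        then show ?thesis using 1 2 by simp
      qed
      then show ?thesis using eq m'2 unfolding s_def[symmetric] s'_def[symmetric] by simp
    qed
  qed
qed

section \<open>Path functionals of a real sequence\<close>

primrec running_max :: "(nat \<Rightarrow> real) \<Rightarrow> nat \<Rightarrow> real" where
  "running_max X 0 = \<bar>X 0\<bar>"
| "running_max X (Suc n) = max (running_max X n) \<bar>X (Suc n)\<bar>"

definition quad_var :: "(nat \<Rightarrow> real) \<Rightarrow> nat \<Rightarrow> real" where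
  "quad_var X n = (\<Sum>i<n. (X (Suc i) - X i)\<^sup>2)"

text \<open>Only values of \<open>X\<close> up to time \<open>n\<close> enter, so the weight is
  known before the increment that it multiplies. If the root vanishes, so does \<open>X n\<close>,
  and the quotient is 0.\<close>

definition davis_weight :: "(nat \<Rightarrow> real) \<Rightarrow> nat \<Rightarrow> real" where
  "davis_weight X n = X n / sqrt (quad_var X n + (running_max X n)\<^sup>2)"

definition davis_transform :: "(nat \<Rightarrow> real) \<Rightarrow> nat \<Rightarrow> real" where
  "davis_transform X n = (\<Sum>i<n. davis_weight X i * (X (Suc i) - X i))"

lemma abs_le_running_max: "i \<le> n \<Longrightarrow> \<bar>X i\<bar> \<le> running_max X n"
  by (induction n) (auto simp: le_Suc_eq)

lemma running_max_nonneg: "0 \<le> running_max X n"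
  using abs_le_running_max[of n n X] by linarith

lemma quad_var_nonneg: "0 \<le> quad_var X n"
  by (simp add: quad_var_def sum_nonneg)

lemma quad_var_Suc: "quad_var X (Suc n) = quad_var X n + (X (Suc n) - X n)\<^sup>2"
  by (simp add: quad_var_def)

lemma pathwise_davis_square_function:
  assumes "X 0 = 0"
  shows "sqrt (quad_var X n) \<le> 4 * running_max X n - davis_transform X n"
proof -
  define w where "w n = sqrt (quad_var X n + (running_max X n)\<^sup>2)" for n
  have "w n + ((running_max X n)\<^sup>2 - (X n)\<^sup>2) / (2 * w n) - 4 * running_max X n
      + davis_transform X n \<le> 0"
  proof (induction n)
    case 0
    then show ?case using assms by (simp add: w_def quad_var_def davis_transform_def)
  next
    case (Suc n)
    have *: "X n + (X (Suc n) - X n) = X (Suc n)" by simp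
    show ?case
      using Suc square_function_step[of "X n" "running_max X n" "quad_var X n" "w n"
          "running_max X (Suc n)" "X (Suc n) - X n" "w (Suc n)", unfolded *]
      by (simp add: abs_le_running_max quad_var_nonneg quad_var_Suc w_def davis_transform_def
          davis_weight_def)
  qed
  moreover have "0 \<le> ((running_max X n)\<^sup>2 - (X n)\<^sup>2) / (2 * w n)"
    using power_mono[OF abs_le_running_max[of n n X], of 2]
    by (simp add: w_def quad_var_nonneg)
  moreover have "sqrt (quad_var X n) \<le> w n"
    by (simp add: w_def)
  ultimately show ?thesis by linarith
qed

text \<open>The fraction in the potential is negative but at least \<open>- (w n / 2)\<close>, so
  half of \<open>w n\<close> survives. Doubling turns the constants 6 and 1 into 12 and 2.\<close>

lemma pathwise_davis_maximal_function:
  assumes "X 0 = 0"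
  shows "running_max X n \<le> 12 * sqrt (quad_var X n) + 2 * davis_transform X n"
proof -
  define w where "w n = sqrt (quad_var X n + (running_max X n)\<^sup>2)" for n
  have "((X n)\<^sup>2 - (running_max X n)\<^sup>2) / (2 * w n) + w n - 6 * sqrt (quad_var X n)
      \<le> davis_transform X n"
  proof (induction n)
    case 0
    then show ?case using assms by (simp add: w_def quad_var_def davis_transform_def)
  next
    case (Suc n)
    have *: "X n + (X (Suc n) - X n) = X (Suc n)" by simp
    show ?case
      using Suc maximal_function_step[of "X n" "running_max X n" "quad_var X n" "w n"
          "running_max X (Suc n)" "X (Suc n) - X n" "w (Suc n)", unfolded *]
      by (simp add: abs_le_running_max quad_var_nonneg quad_var_Suc w_def davis_transform_def
          davis_weight_def)
  qed
  moreover have "- (w n / 2) \<le> ((X n)\<^sup>2 - (running_max X n)\<^sup>2) / (2 * w n)"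
  proof (cases "w n = 0")
    case False
    then have "0 < w n" by (simp add: w_def less_le quad_var_nonneg)
    moreover have "(w n)\<^sup>2 \<ge> (running_max X n)\<^sup>2" by (simp add: w_def quad_var_nonneg)
    then have "(running_max X n)\<^sup>2 - (X n)\<^sup>2 \<le> w n * w n"
      using zero_le_power2[of "X n"] unfolding power2_eq_square[of "w n"] by linarith
    ultimately show ?thesis by (simp add: field_simps)
  qed simp
  moreover have "running_max X n \<le> w n"
    by (simp add: w_def quad_var_nonneg running_max_nonneg real_le_rsqrt)
  ultimately show ?thesis by linarith
qed

text \<open>This and the later congruence rules yield adaptedness: two points in a common cell have
  the same path up to its generation.\<close>

lemma running_max_cong: "(\<And>i. i \<le> n \<Longrightarrow> X i = Y i) \<Longrightarrow> running_max X n = running_max Y n"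
  by (induction n) auto

lemma running_max_attained: "\<exists>i\<le>n. running_max X n = \<bar>X i\<bar>"
proof (induction n)
  case (Suc n)
  then show ?case by (cases "running_max X n \<le> \<bar>X (Suc n)\<bar>") (auto simp: max_def le_Suc_eq)
qed simp

lemma quad_var_cong: "(\<And>i. i \<le> n \<Longrightarrow> X i = Y i) \<Longrightarrow> quad_var X n = quad_var Y n"
  unfolding quad_var_def by (intro sum.cong) auto

lemma davis_weight_cong: "(\<And>i. i \<le> n \<Longrightarrow> X i = Y i) \<Longrightarrow> davis_weight X n = davis_weight Y n"
  using running_max_cong[of n X Y] quad_var_cong[of n X Y] by (simp add: davis_weight_def)

lemma davis_transform_cong:
  assumes "\<And>i. i \<le> n \<Longrightarrow> X i = Y i"
  shows "davis_transform X n = davis_transform Y n"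
  unfolding davis_transform_def
proof (rule sum.cong)
  fix i assume "i \<in> {..<n}"
  then show "davis_weight X i * (X (Suc i) - X i) = davis_weight Y i * (Y (Suc i) - Y i)"
    using davis_weight_cong[of i X Y] assms by simp
qed simp

section \<open>The martingale of a lattice\<close>

text \<open>The nonempty interior serves to show that each generation is countable.\<close>

lemma nd_interval_measure:
  assumes "nd_interval I"
  shows "I \<in> sets borel" "emeasure lborel I < \<infinity>" "0 < measure lborel I" "interior I \<noteq> {}"
proof -
  obtain a b where ab: "a < b" "{a<..<b} \<subseteq> I" "I \<subseteq> {a..b}"
    using assms by (auto simp: nd_interval_def)
  have "x \<in> {a<..<b} \<or> x = a \<or> x = b" if "x \<in> {a..b}" for x
    using that by auto
  then have "I = {a<..<b} \<union> (I \<inter> {a, b})" using ab by blast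
  moreover have "I \<inter> {a, b} \<in> sets borel" by (intro finite_imp_closed borel_closed) auto
  ultimately show I: "I \<in> sets borel" by (metis sets.Un borel_open open_real_greaterThanLessThan)
  have "emeasure lborel I \<le> emeasure lborel {a..b}" using ab I by (intro emeasure_mono) auto
  then show fin: "emeasure lborel I < \<infinity>" using ab by (simp add: le_less_trans)
  have "0 < emeasure lborel {a<..<b}" using ab by simp
  also have "\<dots> \<le> emeasure lborel I" using ab I by (intro emeasure_mono) auto
  finally show "0 < measure lborel I" using fin by (simp add: measure_def enn2real_positive_iff)
  have "{a<..<b} \<subseteq> interior I" using ab by (intro interior_maximal) auto
  then show "interior I \<noteq> {}" using dense[OF ab(1)] by auto
qed

locale lattice_function =
  fixes L :: "int \<Rightarrow> real set set" and f :: "real \<Rightarrow> real"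
  assumes lattice: "lattice L" and integrable: "integrable lborel f"
begin

definition cell :: "int \<Rightarrow> real \<Rightarrow> real set" where
  "cell k x = (THE I. I \<in> L k \<and> x \<in> I)"

definition mart :: "int \<Rightarrow> real \<Rightarrow> real" where
  "mart k x = avg f (cell k x)"

text \<open>Adaptedness is constancy on cells instead of measurability for a sigma-algebra; Borel
  measurability follows because generations are countable.\<close>

definition adapted :: "int \<Rightarrow> (real \<Rightarrow> real) \<Rightarrow> bool" where
  "adapted k u \<longleftrightarrow> (\<forall>x y. cell k x = cell k y \<longrightarrow> u x = u y)"

section \<open>Nested cells and finite subdivisions\<close>

lemma lattice_generation:
  shows nd_cell: "I \<in> L k \<Longrightarrow> nd_interval I"
    and disjoint_L: "disjoint (L k)"
    and Union_L: "\<Union>(L k) = UNIV"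
    and finite_partition: "I \<in> L k \<Longrightarrow> \<exists>F. finite F \<and> F \<subseteq> L (k + 1) \<and> disjoint F \<and> \<Union>F = I"
  using lattice by (simp_all add: lattice_def)

lemma disjoint_generation: "I \<in> L k \<Longrightarrow> J \<in> L k \<Longrightarrow> x \<in> I \<Longrightarrow> x \<in> J \<Longrightarrow> I = J"
  using disjointD[OF disjoint_L, of I k J] by auto

lemma generation_cover: "\<exists>I\<in>L k. x \<in> I"
  using Union_L[of k] by (metis UNIV_I UnionE)

lemma cell_eq: "I \<in> L k \<Longrightarrow> x \<in> I \<Longrightarrow> cell k x = I"
  unfolding cell_def by (rule the_equality) (simp, metis disjoint_generation)

lemma cell_in: "cell k x \<in> L k" and mem_cell: "x \<in> cell k x"
  using generation_cover[of k x] by (auto simp: cell_eq)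

lemmas sets_cell = nd_interval_measure(1)[OF nd_cell]
  and emeasure_cell = nd_interval_measure(2)[OF nd_cell]
  and measure_cell = nd_interval_measure(3)[OF nd_cell]

lemma cell_nonempty: "I \<in> L k \<Longrightarrow> \<exists>x. x \<in> I"
  using nd_interval_measure(4)[OF nd_cell, of I k] interior_subset[of I] by auto

lemma countable_generation: "countable (L k)"
proof (rule countable_disjoint_nonempty_interior_subsets)
  show "disjoint (L k)" by (rule disjoint_L)
qed (simp add: nd_interval_measure(4)[OF nd_cell])

text \<open>The finite partition given by the lattice is forced to consist of all next cells inside
  \<open>I\<close>: such a cell shares a point with a member of the partition and equals it by
  disjointness.\<close>

lemma subcells_Suc:
  assumes "I \<in> L k"
  shows "finite {J \<in> L (k + 1). J \<subseteq> I}" "\<Union>{J \<in> L (k + 1). J \<subseteq> I} = I"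
proof -
  obtain F where F: "finite F" "F \<subseteq> L (k + 1)" "\<Union>F = I"
    using finite_partition[OF assms] by blast
  have "J \<in> F" if "J \<in> L (k + 1)" "J \<subseteq> I" for J
  proof -
    obtain x where "x \<in> J" using cell_nonempty[OF \<open>J \<in> L (k + 1)\<close>] by blast
    then obtain K where "K \<in> F" "x \<in> K" using \<open>J \<subseteq> I\<close> F by blast
    then show ?thesis using disjoint_generation[of J "k + 1" K x] that F \<open>x \<in> J\<close> by auto
  qed
  then have "{J \<in> L (k + 1). J \<subseteq> I} = F" using F by blast
  then show "finite {J \<in> L (k + 1). J \<subseteq> I}" "\<Union>{J \<in> L (k + 1). J \<subseteq> I} = I" using F by auto
qed

lemma cell_Suc_subset: "cell (k + 1) x \<subseteq> cell k x"
proof -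
  obtain J where J: "J \<in> L (k + 1)" "J \<subseteq> cell k x" "x \<in> J"
    using subcells_Suc(2)[OF cell_in[of k x]] mem_cell[of x k] by blast
  then show ?thesis using cell_eq[OF J(1,3)] by simp
qed

lemma cell_antimono: "j \<le> k \<Longrightarrow> cell k x \<subseteq> cell j x"
proof (induction k rule: int_ge_induct)
  case (step i)
  then show ?case using cell_Suc_subset[of i x] by blast
qed simp

text \<open>Nesting lets a later cell determine all earlier ones; this is the monotonicity of the
  filtration.\<close>

lemma cell_mono_eq: "j \<le> k \<Longrightarrow> cell k x = cell k y \<Longrightarrow> cell j x = cell j y"
proof -
  assume jk: "j \<le> k" and eq: "cell k x = cell k y"
  have "y \<in> cell j x" using cell_antimono[OF jk, of x] mem_cell[of y k] eq by auto
  then show ?thesis using cell_eq[OF cell_in] by metis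
qed

text \<open>Finiteness makes adapted functions integrable over earlier cells. It is inherited
  because each subcell of generation \<open>j + 1\<close> lies in one of the finitely many of
  generation \<open>j\<close>.\<close>

lemma subcells:
  assumes "I \<in> L k" "k \<le> l"
  shows "finite {J \<in> L l. J \<subseteq> I}" "\<Union>{J \<in> L l. J \<subseteq> I} = I"
proof -
  have cover: "\<Union>{J \<in> L j. J \<subseteq> I} = I" if "k \<le> j" for j
  proof -
    have "cell j x \<in> {J \<in> L j. J \<subseteq> I}" if "x \<in> I" for x
      using cell_antimono[OF \<open>k \<le> j\<close>, of x] cell_eq[OF assms(1) that] cell_in[of j x] by simp
    then show ?thesis using mem_cell[of _ j] by fast
  qed
  then show "\<Union>{J \<in> L l. J \<subseteq> I} = I" using assms by simp
  show "finite {J \<in> L l. J \<subseteq> I}"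
    using assms(2)
  proof (induction l rule: int_ge_induct)
    case base
    have "J = I" if J: "J \<in> L k" "J \<subseteq> I" for J
    proof -
      obtain x where "x \<in> J" using cell_nonempty[OF J(1)] by blast
      then show ?thesis using disjoint_generation[OF J(1) assms(1), of x] J(2) by auto
    qed
    then have "{J \<in> L k. J \<subseteq> I} \<subseteq> {I}" by blast
    then show ?case by (rule finite_subset) simp
  next
    case (step j)
    have "{J \<in> L (j + 1). J \<subseteq> I} \<subseteq> (\<Union>K\<in>{K \<in> L j. K \<subseteq> I}. {J \<in> L (j + 1). J \<subseteq> K})"
    proof safe
      fix J assume J: "J \<in> L (j + 1)" "J \<subseteq> I"
      obtain x where x: "x \<in> J" using cell_nonempty[OF J(1)] by blast
      then have "J \<subseteq> cell j x" using cell_Suc_subset[of j x] cell_eq[OF J(1)] by simp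
      moreover have "cell j x \<subseteq> I"
        using cell_antimono[OF step(1), of x] cell_eq[OF assms(1), of x] x J by auto
      ultimately show "J \<in> (\<Union>K\<in>{K \<in> L j. K \<subseteq> I}. {J \<in> L (j + 1). J \<subseteq> K})"
        using cell_in[of j x] J by blast
    qed
    then show ?case using step subcells_Suc(1) by (elim finite_subset) auto
  qed
qed

section \<open>Functions constant on the cells of a generation\<close>

lemma adapted_const: "adapted k u \<Longrightarrow> I \<in> L k \<Longrightarrow> x \<in> I \<Longrightarrow> y \<in> I \<Longrightarrow> u x = u y"
  unfolding adapted_def by (simp add: cell_eq)

lemma adapted_mono: "adapted j u \<Longrightarrow> j \<le> k \<Longrightarrow> adapted k u"
  unfolding adapted_def by (metis cell_mono_eq)

lemma adapted_comp2:
  "adapted k u \<Longrightarrow> adapted k v \<Longrightarrow> adapted k (\<lambda>x. F (u x) (v x))"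
  unfolding adapted_def by metis

lemma adapted_mart: "adapted k (mart k)"
  by (simp add: adapted_def mart_def)

text \<open>A preimage is a union of cells, of which there are only countably many.\<close>

lemma adapted_measurable:
  assumes "adapted k u"
  shows "u \<in> borel_measurable borel"
proof (rule borel_measurableI)
  fix S :: "real set"
  have "u -` S = \<Union>{I \<in> L k. I \<subseteq> u -` S}"
  proof (intro equalityI subsetI)
    fix x assume "x \<in> u -` S"
    then have "u y \<in> S" if "y \<in> cell k x" for y
      using adapted_const[OF assms cell_in that mem_cell] by simp
    then have "cell k x \<in> {I \<in> L k. I \<subseteq> u -` S}" using cell_in by auto
    then show "x \<in> \<Union>{I \<in> L k. I \<subseteq> u -` S}" using mem_cell[of x k] by blast
  qed blast
  also have "\<dots> \<in> sets borel"
  proof (rule sets.countable_Union)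
    show "countable {I \<in> L k. I \<subseteq> u -` S}"
      by (rule countable_subset[OF _ countable_generation[of k]]) blast
    show "{I \<in> L k. I \<subseteq> u -` S} \<subseteq> sets borel" using sets_cell[of _ k] by blast
  qed
  finally show "u -` S \<inter> space borel \<in> sets borel" by simp
qed

text \<open>On \<open>I\<close> the function is constant on each of finitely many cells of finite
  measure.\<close>

lemma adapted_set_integrable:
  assumes I: "I \<in> L k" and kl: "k \<le> l" and u: "adapted l u"
  shows "set_integrable lborel I u"
proof -
  have "set_integrable lborel (\<Union>J\<in>{J \<in> L l. J \<subseteq> I}. J) u"
  proof (rule set_integrable_UN)
    fix J assume "J \<in> {J \<in> L l. J \<subseteq> I}"
    then have J: "J \<in> L l" by blast
    then obtain x where x: "x \<in> J" using cell_nonempty by blast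
    have "set_integrable lborel J u \<longleftrightarrow> set_integrable lborel J (\<lambda>_. u x)"
      by (intro set_integrable_cong refl adapted_const[OF u J _ x])
    also have "\<dots>" using sets_cell[OF J] emeasure_cell[OF J] by (simp add: set_integrable_def)
    finally show "set_integrable lborel J u" .
    show "J \<in> sets lborel" using sets_cell[OF J] by simp
  qed (use subcells(1)[OF I kl] in auto)
  then show ?thesis using subcells(2)[OF I kl] by simp
qed

section \<open>The martingale property\<close>

lemma set_integral_subcells:
  assumes I: "I \<in> L k" and kl: "k \<le> l" and u: "set_integrable lborel I (u :: real \<Rightarrow> real)"
  shows "(LINT x:I|lborel. u x) = (\<Sum>J\<in>{J \<in> L l. J \<subseteq> I}. LINT x:J|lborel. u x)"
proof -
  have "(LINT x:(\<Union>J\<in>{J \<in> L l. J \<subseteq> I}. J)|lborel. u x)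
      = (\<Sum>J\<in>{J \<in> L l. J \<subseteq> I}. LINT x:J|lborel. u x)"
  proof (rule set_integral_finite_Union)
    show "disjoint_family_on (\<lambda>J. J) {J \<in> L l. J \<subseteq> I}"
      using disjoint_generation unfolding disjoint_family_on_def by blast
    show "finite {J \<in> L l. J \<subseteq> I}" by (rule subcells(1)[OF I kl])
    fix J assume J: "J \<in> {J \<in> L l. J \<subseteq> I}"
    then show "J \<in> sets lborel" using sets_cell[of J l] by simp
    then show "set_integrable lborel J u" using J by (intro set_integrable_subset[OF u]) auto
  qed
  then show ?thesis using subcells(2)[OF I kl] by simp
qed

lemma set_integrable_f: "A \<in> sets borel \<Longrightarrow> set_integrable lborel A f"
  unfolding set_integrable_def using integrable_mult_indicator[OF _ integrable] by simp

lemma set_integral_mart_cell: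
  assumes I: "I \<in> L k"
  shows "(LINT x:I|lborel. mart k x) = (LINT x:I|lborel. f x)"
proof -
  have "(LINT x:I|lborel. mart k x) = (LINT x:I|lborel. avg f I)"
    using sets_cell[OF I] by (intro set_lebesgue_integral_cong) (auto simp: mart_def cell_eq[OF I])
  also have "\<dots> = (LINT x:I|lborel. f x)"
    using sets_cell[OF I] emeasure_cell[OF I] measure_cell[OF I]
    by (simp add: set_integral_const avg_def)
  finally show ?thesis .
qed

text \<open>This is the martingale property in integrated form: averaging over the subcells of
  \<open>I\<close> keeps the integral over \<open>I\<close>.\<close>

lemma set_integral_mart:
  assumes I: "I \<in> L k" and kl: "k \<le> l"
  shows "(LINT x:I|lborel. mart l x) = (LINT x:I|lborel. f x)"
proof -
  have "(LINT x:I|lborel. mart l x) = (\<Sum>J\<in>{J \<in> L l. J \<subseteq> I}. LINT x:J|lborel. mart l x)"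
    by (intro set_integral_subcells[OF I kl] adapted_set_integrable[OF I kl] adapted_mart)
  also have "\<dots> = (\<Sum>J\<in>{J \<in> L l. J \<subseteq> I}. LINT x:J|lborel. f x)"
    by (intro sum.cong) (auto simp: set_integral_mart_cell)
  also have "\<dots> = (LINT x:I|lborel. f x)"
    by (intro set_integral_subcells[OF I kl, symmetric] set_integrable_f sets_cell[OF I])
  finally show ?thesis .
qed

text \<open>Increments are orthogonal to the past. On a subcell of generation \<open>l\<close> the
  weight is a constant factor, and \<open>mart l\<close> and \<open>mart (l + 1)\<close> both
  integrate to the integral of \<open>f\<close>.\<close>

lemma set_integral_weighted_increment:
  assumes I: "I \<in> L k" and kl: "k \<le> l" and u: "adapted l u"
  shows "(LINT x:I|lborel. u x * (mart (l + 1) x - mart l x)) = 0"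
proof -
  have ad: "adapted (l + 1) (\<lambda>x. u x * (mart (l + 1) x - mart l x))"
    using kl u by (intro adapted_comp2[where F = "(*)"] adapted_comp2[where F = "(-)"] adapted_mart
        adapted_mono[OF u] adapted_mono[OF adapted_mart[of l]]) auto
  have "(LINT x:I|lborel. u x * (mart (l + 1) x - mart l x))
      = (\<Sum>J\<in>{J \<in> L l. J \<subseteq> I}. LINT x:J|lborel. u x * (mart (l + 1) x - mart l x))"
    using kl by (intro set_integral_subcells[OF I kl] adapted_set_integrable[OF I _ ad]) simp
  also have "\<dots> = 0"
  proof (rule sum.neutral, rule ballI)
    fix J assume "J \<in> {J \<in> L l. J \<subseteq> I}"
    then have J: "J \<in> L l" by blast
    then obtain z where z: "z \<in> J" using cell_nonempty by blast
    have "(LINT x:J|lborel. u x * (mart (l + 1) x - mart l x))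
        = (LINT x:J|lborel. u z * (mart (l + 1) x - mart l x))"
    proof (rule set_lebesgue_integral_cong)
      show "\<forall>x. x \<in> J \<longrightarrow> u x * (mart (l + 1) x - mart l x) = u z * (mart (l + 1) x - mart l x)"
        using adapted_const[OF u J _ z] by metis
    qed (use sets_cell[OF J] in simp)
    also have "\<dots> = u z * ((LINT x:J|lborel. mart (l + 1) x) - (LINT x:J|lborel. mart l x))"
      using adapted_set_integrable[OF J _ adapted_mart] by (simp add: set_integral_diff(2))
    also have "\<dots> = 0" using set_integral_mart[OF J] by simp
    finally show "(LINT x:J|lborel. u x * (mart (l + 1) x - mart l x)) = 0" .
  qed
  finally show ?thesis .
qed

text \<open>Global integrals may be infinite, so inequalities are proved on single cells, where
  everything adapted is integrable, and then summed.\<close>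

lemma nn_integral_cellwise_mono:
  assumes [measurable]: "u \<in> borel_measurable borel" "v \<in> borel_measurable borel"
    and le: "\<And>I. I \<in> L k \<Longrightarrow> (\<integral>\<^sup>+x\<in>I. u x \<partial>lborel) \<le> (\<integral>\<^sup>+x\<in>I. v x \<partial>lborel)"
  shows "(\<integral>\<^sup>+x. u x \<partial>lborel) \<le> (\<integral>\<^sup>+x. v x \<partial>lborel)"
proof -
  \<comment> \<open>The empty set fills the indices outside the range of the enumeration, so that
    the generation need not be shown to be infinite.\<close>
  define B where "B n = (if n \<in> to_nat_on (L k) ` L k then from_nat_into (L k) n else {})" for n
  have B: "B n \<in> L k \<or> B n = {}" for n
    using countable_generation[of k] by (auto simp: B_def)
  have sets_B: "B n \<in> sets borel" for n using B[of n] sets_cell by auto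
  have idx: "n = to_nat_on (L k) (B n)" if "x \<in> B n" for n x
    using that countable_generation[of k] by (auto simp: B_def split: if_splits)
  have "disjoint_family B"
  proof (unfold disjoint_family_on_def, intro ballI impI)
    fix m n :: nat assume "m \<noteq> n"
    have False if x: "x \<in> B m" "x \<in> B n" for x
    proof -
      have "B m \<in> L k" "B n \<in> L k" using B[of m] B[of n] x by auto
      then have "B m = B n" using x by (rule disjoint_generation)
      then show False using \<open>m \<noteq> n\<close> idx[OF x(1)] idx[OF x(2)] by simp
    qed
    then show "B m \<inter> B n = {}" by blast
  qed
  have "(\<Union>n. B n) = UNIV"
  proof -
    have "x \<in> B (to_nat_on (L k) (cell k x))" for x
      using countable_generation[of k] cell_in[of k x] mem_cell[of x k] by (simp add: B_def)
    then show ?thesis by blast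
  qed
  then have eq: "(\<integral>\<^sup>+x. w x \<partial>lborel) = (\<Sum>n. (\<integral>\<^sup>+x\<in>B n. w x \<partial>lborel))"
    if [measurable]: "w \<in> borel_measurable borel" for w
    using nn_integral_disjoint_family[of w lborel B] \<open>disjoint_family B\<close> sets_B that by simp
  have "(\<integral>\<^sup>+x\<in>B n. u x \<partial>lborel) \<le> (\<integral>\<^sup>+x\<in>B n. v x \<partial>lborel)" for n
    using B[of n] le by auto
  then show ?thesis by (simp add: eq suminf_le)
qed

text \<open>The function \<open>h\<close> is integrable over each cell of generation
  \<open>k\<close> but not necessarily over the line; hence its vanishing integral is used cell by
  cell.\<close>

lemma nn_integral_le_of_set_integral_zero:
  assumes kl: "k \<le> l" and ad: "adapted l u" "adapted l v" "adapted l h"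
    and u0: "\<And>x. 0 \<le> u x" and le: "\<And>x. u x \<le> v x + h x"
    and v0: "\<And>x. 0 \<le> v x"
    and h0: "\<And>I. I \<in> L k \<Longrightarrow> (LINT x:I|lborel. h x) = 0"
  shows "(\<integral>\<^sup>+x. ennreal (u x) \<partial>lborel) \<le> (\<integral>\<^sup>+x. ennreal (v x) \<partial>lborel)"
proof (rule nn_integral_cellwise_mono[where k = k])
  fix I assume I: "I \<in> L k"
  note int = adapted_set_integrable[OF I kl]
  have nn: "(\<integral>\<^sup>+x\<in>I. ennreal (w x) \<partial>lborel) = ennreal (LINT x:I|lborel. w x)"
    if "adapted l w" "\<And>x. 0 \<le> w x" for w
  proof -
    have "(\<integral>\<^sup>+x\<in>I. ennreal (w x) \<partial>lborel) = (\<integral>\<^sup>+x. ennreal (indicator I x *\<^sub>R w x) \<partial>lborel)"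
      by (intro nn_integral_cong) (auto split: split_indicator)
    also have "\<dots> = ennreal (LINT x:I|lborel. w x)"
      unfolding set_lebesgue_integral_def using int[OF that(1)] that(2)
      by (intro nn_integral_eq_integral) (auto simp: set_integrable_def)
    finally show ?thesis .
  qed
  have "(LINT x:I|lborel. u x) \<le> (LINT x:I|lborel. v x + h x)"
    using le int[OF ad(1)] set_integral_add(1)[OF int[OF ad(2)] int[OF ad(3)]]
    by (intro set_integral_mono) auto
  also have "\<dots> = (LINT x:I|lborel. v x)"
    using set_integral_add(2)[OF int[OF ad(2)] int[OF ad(3)]] h0[OF I] by simp
  finally show "(\<integral>\<^sup>+x\<in>I. ennreal (u x) \<partial>lborel) \<le> (\<integral>\<^sup>+x\<in>I. ennreal (v x) \<partial>lborel)"
    using nn ad u0 v0 by (simp add: ennreal_leI)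
next
  show "(\<lambda>x. ennreal (u x)) \<in> borel_measurable borel" "(\<lambda>x. ennreal (v x)) \<in> borel_measurable borel"
    using ad adapted_measurable by (intro measurable_compose[OF _ measurable_ennreal]; blast)+
qed

section \<open>Davis' inequality on a finite time interval\<close>

definition incr :: "int \<Rightarrow> real \<Rightarrow> nat \<Rightarrow> real" where
  "incr k x n = mart (k + int n) x - mart k x"

lemma incr_eq:
  assumes "cell (k + int n) x = cell (k + int n) y" "i \<le> n"
  shows "incr k x i = incr k y i"
proof -
  have "cell (k + int i) x = cell (k + int i) y" "cell k x = cell k y"
    by (rule cell_mono_eq[OF _ assms(1)], use assms(2) in simp)+
  then show ?thesis by (simp add: incr_def mart_def)
qed

lemma adapted_functionals:
  shows adapted_running_max: "adapted (k + int n) (\<lambda>x. running_max (incr k x) n)"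
    and adapted_quad_var: "adapted (k + int n) (\<lambda>x. quad_var (incr k x) n)"
    and adapted_davis_weight: "adapted (k + int n) (\<lambda>x. davis_weight (incr k x) n)"
    and adapted_davis_transform: "adapted (k + int n) (\<lambda>x. davis_transform (incr k x) n)"
  unfolding adapted_def
  by (intro allI impI running_max_cong quad_var_cong davis_weight_cong davis_transform_cong,
      erule (1) incr_eq)+

lemma measurable_functionals [measurable]:
  shows "(\<lambda>x. running_max (incr k x) n) \<in> borel_measurable borel"
    and "(\<lambda>x. quad_var (incr k x) n) \<in> borel_measurable borel"
  by (rule adapted_measurable[OF adapted_running_max], rule adapted_measurable[OF adapted_quad_var])

text \<open>Each summand is a weighted increment: the weight is adapted to generation
  \<open>k + int n\<close>, the increment leads to the next one.\<close>

lemma set_integral_davis_transform: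
  assumes I: "I \<in> L k"
  shows "(LINT x:I|lborel. davis_transform (incr k x) n) = 0"
proof (induction n)
  case 0
  then show ?case by (simp add: davis_transform_def)
next
  case (Suc n)
  have step: "davis_transform (incr k x) (Suc n) = davis_transform (incr k x) n
      + davis_weight (incr k x) n * (mart (k + int n + 1) x - mart (k + int n) x)" for x
    by (simp add: davis_transform_def incr_def add.assoc add.commute[of 1])
  have "set_integrable lborel I (\<lambda>x. davis_transform (incr k x) n)"
    by (rule adapted_set_integrable[OF I _ adapted_davis_transform]) simp
  moreover have "set_integrable lborel I
      (\<lambda>x. davis_weight (incr k x) n * (mart (k + int n + 1) x - mart (k + int n) x))"
    by (rule adapted_set_integrable[OF I, where l = "k + int n + 1"])
      (auto intro!: adapted_comp2[where F = "(*)"] adapted_comp2[where F = "(-)"] adapted_mart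
        adapted_mono[OF adapted_davis_weight] adapted_mono[OF adapted_mart[of "k + int n"]])
  ultimately show ?case
    using Suc set_integral_weighted_increment[OF I _ adapted_davis_weight[of k n]]
    by (simp add: step set_integral_add)
qed

text \<open>The pathwise inequality is integrated; the transform, here with a minus sign, drops out
  on each cell of generation \<open>k\<close>.\<close>

lemma nn_integral_quad_var_le:
  "(\<integral>\<^sup>+x. ennreal (sqrt (quad_var (incr k x) n)) \<partial>lborel)
    \<le> 4 * (\<integral>\<^sup>+x. ennreal (running_max (incr k x) n) \<partial>lborel)"
proof -
  have "(\<integral>\<^sup>+x. ennreal (sqrt (quad_var (incr k x) n)) \<partial>lborel)
      \<le> (\<integral>\<^sup>+x. ennreal (4 * running_max (incr k x) n) \<partial>lborel)"
  proof (rule nn_integral_le_of_set_integral_zero[where k = k and l = "k + int n"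
        and h = "\<lambda>x. - davis_transform (incr k x) n"])
    show "adapted (k + int n) (\<lambda>x. sqrt (quad_var (incr k x) n))"
      "adapted (k + int n) (\<lambda>x. 4 * running_max (incr k x) n)"
      "adapted (k + int n) (\<lambda>x. - davis_transform (incr k x) n)"
      using adapted_functionals[of k n] unfolding adapted_def by metis+
    show "sqrt (quad_var (incr k x) n)
        \<le> 4 * running_max (incr k x) n + - davis_transform (incr k x) n" for x
      using pathwise_davis_square_function[of "incr k x" n] by (simp add: incr_def)
    show "(LINT x:I|lborel. - davis_transform (incr k x) n) = 0" if "I \<in> L k" for I
      using set_integral_davis_transform[OF that, of n]
      by (simp add: set_lebesgue_integral_def)
  qed (auto simp: quad_var_nonneg running_max_nonneg)
  also have "\<dots> = 4 * (\<integral>\<^sup>+x. ennreal (running_max (incr k x) n) \<partial>lborel)"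
    by (simp add: ennreal_mult running_max_nonneg nn_integral_cmult)
  finally show ?thesis .
qed

lemma nn_integral_running_max_le:
  "(\<integral>\<^sup>+x. ennreal (running_max (incr k x) n) \<partial>lborel)
    \<le> 12 * (\<integral>\<^sup>+x. ennreal (sqrt (quad_var (incr k x) n)) \<partial>lborel)"
proof -
  have "(\<integral>\<^sup>+x. ennreal (running_max (incr k x) n) \<partial>lborel)
      \<le> (\<integral>\<^sup>+x. ennreal (12 * sqrt (quad_var (incr k x) n)) \<partial>lborel)"
  proof (rule nn_integral_le_of_set_integral_zero[where k = k and l = "k + int n"
        and h = "\<lambda>x. 2 * davis_transform (incr k x) n"])
    show "adapted (k + int n) (\<lambda>x. running_max (incr k x) n)"
      "adapted (k + int n) (\<lambda>x. 12 * sqrt (quad_var (incr k x) n))"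
      "adapted (k + int n) (\<lambda>x. 2 * davis_transform (incr k x) n)"
      using adapted_functionals[of k n] unfolding adapted_def by metis+
    show "running_max (incr k x) n
        \<le> 12 * sqrt (quad_var (incr k x) n) + 2 * davis_transform (incr k x) n" for x
      using pathwise_davis_maximal_function[of "incr k x" n] by (simp add: incr_def)
    show "(LINT x:I|lborel. 2 * davis_transform (incr k x) n) = 0" if "I \<in> L k" for I
      using set_integral_davis_transform[OF that, of n] by simp
  qed (auto simp: quad_var_nonneg running_max_nonneg)
  also have "\<dots> = 12 * (\<integral>\<^sup>+x. ennreal (sqrt (quad_var (incr k x) n)) \<partial>lborel)"
    by (simp add: ennreal_mult quad_var_nonneg nn_integral_cmult)
  finally show ?thesis .
qed

end

section \<open>Maximal and square functions\<close>

lemma sqrt_enn_ennreal: "0 \<le> a \<Longrightarrow> sqrt_enn (ennreal a) = ennreal (sqrt a)"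
  by (simp add: sqrt_enn_def)

lemma sqrt_enn_mono:
  assumes "a \<le> b"
  shows "sqrt_enn a \<le> sqrt_enn b"
proof (cases "b = \<infinity>")
  case False
  then have "a \<noteq> \<infinity>" "enn2real a \<le> enn2real b"
    using assms by (auto simp: top_unique less_top intro: enn2real_mono)
  then show ?thesis using False by (simp add: sqrt_enn_def ennreal_leI)
qed (simp add: sqrt_enn_def)

lemma sqrt_enn_add_le: "sqrt_enn (a + b) \<le> sqrt_enn a + sqrt_enn b"
proof (cases a; cases b)
  fix r s :: real assume "a = ennreal r" "0 \<le> r" "b = ennreal s" "0 \<le> s"
  then show ?thesis
    using sqrt_add_le_add_sqrt[of r s]
    by (simp add: sqrt_enn_ennreal flip: ennreal_plus)
qed (simp_all add: sqrt_enn_def)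

lemma sqrt_enn_SUP_le:
  fixes q :: "nat \<Rightarrow> real"
  assumes q: "\<And>n. 0 \<le> q n"
  shows "sqrt_enn (SUP n. ennreal (q n)) \<le> (SUP n. ennreal (sqrt (q n)))"
proof (cases "SUP n. ennreal (sqrt (q n))")
  case (real b)
  have "ennreal (q n) \<le> ennreal (b\<^sup>2)" for n
  proof -
    have "ennreal (sqrt (q n)) \<le> ennreal b" unfolding real(2)[symmetric] by (rule SUP_upper) simp
    then have "sqrt (q n) \<le> b" using real by simp
    then have "q n \<le> b\<^sup>2" using real by (simp add: sqrt_le_D)
    then show ?thesis by (rule ennreal_leI)
  qed
  then have "(SUP n. ennreal (q n)) \<le> ennreal (b\<^sup>2)" by (rule SUP_least)
  then have "sqrt_enn (SUP n. ennreal (q n)) \<le> sqrt_enn (ennreal (b\<^sup>2))" by (rule sqrt_enn_mono)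
  also have "\<dots> = ennreal b" using real by (simp add: sqrt_enn_ennreal)
  finally show ?thesis using real by simp
next
  case top
  then show ?thesis by (simp only: top_greatest)
qed

section \<open>The maximal function along the generations\<close>

context lattice_function
begin

text \<open>The lattice intervals through \<open>x\<close> are exactly its cells. This makes the
  supremum countable over a fixed index set and thus measurable in \<open>x\<close>.\<close>

lemma maxf_eq: "maxf L f x = (SUP k. ennreal \<bar>mart k x\<bar>)"
proof -
  have "{I \<in> lat_set L. x \<in> I} = range (\<lambda>k. cell k x)"
  proof safe
    fix I assume "x \<in> I" "I \<in> lat_set L"
    then show "I \<in> range (\<lambda>k. cell k x)" using cell_eq by (fastforce simp: lat_set_def)
  next
    fix k show "cell k x \<in> lat_set L" using cell_in[of k x] by (auto simp: lat_set_def)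
  qed (rule mem_cell)
  then show ?thesis by (simp add: maxf_def mart_def image_image)
qed

lemma mart_le_maxf: "ennreal \<bar>mart k x\<bar> \<le> maxf L f x"
  unfolding maxf_eq by (rule SUP_upper) simp

lemma measurable_mart [measurable]: "mart k \<in> borel_measurable borel"
  by (rule adapted_measurable[OF adapted_mart])

lemma measurable_maxf [measurable]: "maxf L f \<in> borel_measurable borel"
proof -
  have "(\<lambda>x. SUP k. ennreal \<bar>mart k x\<bar>) \<in> borel_measurable borel" by measurable
  then show ?thesis by (simp add: maxf_eq[abs_def])
qed

text \<open>The factor 2 is the price of subtracting the initial value
  \<open>mart k x\<close>.\<close>

lemma running_max_le_maxf: "ennreal (running_max (incr k x) n) \<le> 2 * maxf L f x"
proof -
  obtain i where "running_max (incr k x) n = \<bar>incr k x i\<bar>"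
    using running_max_attained[of n "incr k x"] by blast
  also have "\<dots> \<le> \<bar>mart (k + int i) x\<bar> + \<bar>mart k x\<bar>" by (simp add: incr_def)
  finally have "ennreal (running_max (incr k x) n)
      \<le> ennreal \<bar>mart (k + int i) x\<bar> + ennreal \<bar>mart k x\<bar>"
    by (simp add: ennreal_leI flip: ennreal_plus)
  also have "\<dots> \<le> maxf L f x + maxf L f x" by (intro add_mono mart_le_maxf)
  finally show ?thesis by (simp add: mult_2)
qed

section \<open>The limit at time minus infinity\<close>

definition top_cell :: "real \<Rightarrow> real set" where
  "top_cell x = (\<Union>k. cell k x)"

text \<open>This is the limit of the martingale at minus infinity. On a top cell of infinite measure
  it is 0, as the integrals of \<open>f\<close> converge while the lengths of the cells tend to
  infinity.\<close>

definition tail :: "real \<Rightarrow> real" where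
  "tail x = (if emeasure lborel (top_cell x) < \<infinity> then avg f (top_cell x) else 0)"

lemma tendsto_tail: "(\<lambda>n. mart (- int n) x) \<longlonglongrightarrow> tail x"
proof -
  define C where "C n = cell (- int n) x" for n
  have [measurable]: "C n \<in> sets borel" for n unfolding C_def by (rule sets_cell[OF cell_in])
  have inc: "incseq C" unfolding incseq_def C_def by (intro allI impI cell_antimono) simp
  have top: "top_cell x = (\<Union>n. C n)"
  proof -
    have "cell k x \<subseteq> C (nat (- k))" for k
      unfolding C_def by (rule cell_antimono) simp
    then show ?thesis unfolding top_cell_def C_def by blast
  qed
  have int: "(\<lambda>n. LINT y:C n|lborel. f y) \<longlonglongrightarrow> (LINT y:top_cell x|lborel. f y)"
    unfolding top by (rule set_integral_cont_up[OF _ inc]) (auto intro: set_integrable_f)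
  have em: "(\<lambda>n. emeasure lborel (C n)) \<longlonglongrightarrow> emeasure lborel (top_cell x)"
    unfolding top by (rule Lim_emeasure_incseq) (auto intro: inc)
  have fin: "emeasure lborel (C n) < \<infinity>" for n unfolding C_def by (rule emeasure_cell[OF cell_in])
  have mart: "mart (- int n) x = (LINT y:C n|lborel. f y) / measure lborel (C n)" for n
    by (simp add: mart_def avg_def C_def)
  show ?thesis
  proof (cases "emeasure lborel (top_cell x) < \<infinity>")
    case True
    have "(\<lambda>n. measure lborel (C n)) \<longlonglongrightarrow> measure lborel (top_cell x)"
      using True unfolding top by (intro Lim_measure_incseq inc) auto
    \<comment> \<open>The limit of the denominators must be nonzero for the quotient to
      converge.\<close>
    moreover have "measure lborel (C 0) \<le> measure lborel (top_cell x)"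
      using True unfolding top by (intro measure_mono_fmeasurable) (auto simp: fmeasurable_def)
    then have "measure lborel (top_cell x) \<noteq> 0"
      using measure_cell[OF cell_in[of 0 x]] by (simp add: C_def)
    ultimately show ?thesis
      using True tendsto_divide[OF int] by (simp add: mart tail_def avg_def)
  next
    case False
    then have "emeasure lborel (top_cell x) = \<infinity>" by (simp add: not_less top_unique)
    moreover have "emeasure lborel (C n) = ennreal (measure lborel (C n))" for n
      using fin[of n] by (intro emeasure_eq_ennreal_measure) simp
    ultimately have "(\<lambda>n. ennreal (measure lborel (C n))) \<longlonglongrightarrow> \<infinity>" using em by simp
    then have "filterlim (\<lambda>n. measure lborel (C n)) at_top sequentially"
      by (simp add: ennreal_tendsto_top_eq_at_top)
    then have "(\<lambda>n. mart (- int n) x) \<longlonglongrightarrow> 0"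
      unfolding mart by (intro tendsto_divide_0[OF int] filterlim_at_top_imp_at_infinity)
    then show ?thesis using False by (simp add: tail_def)
  qed
qed

lemma measurable_tail [measurable]: "tail \<in> borel_measurable borel"
  by (rule borel_measurable_LIMSEQ_metric[OF measurable_mart tendsto_tail])

lemma tail_le_maxf: "ennreal \<bar>tail x\<bar> \<le> maxf L f x"
proof (rule LIMSEQ_le_const2)
  show "(\<lambda>n. ennreal \<bar>mart (- int n) x\<bar>) \<longlonglongrightarrow> ennreal \<bar>tail x\<bar>"
    by (intro tendsto_ennrealI tendsto_rabs tendsto_tail)
qed (simp add: mart_le_maxf)

text \<open>A chain containing \<open>x\<close> in its member \<open>I j\<close> agrees with the
  cells of \<open>x\<close> in all generations up to \<open>j\<close>; later members lie inside
  \<open>I j\<close>, so the unions coincide. Hence at most one term of the second sum in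
  \<open>sqf\<close> is nonzero at \<open>x\<close>.\<close>

lemma A_minf_fin_eq_top_cell:
  assumes "A \<in> A_minf_fin L" "x \<in> A"
  shows "A = top_cell x"
proof -
  obtain I where I: "lat_chain L I" "A = \<Union>(range I)"
    using assms by (auto simp: A_minf_fin_def)
  then obtain j where j: "x \<in> I j" using assms by blast
  have L: "I k \<in> L k" and sub: "I k \<subseteq> I (k - 1)" for k
    using I by (simp_all add: lat_chain_def)
  have anti: "I l \<subseteq> I k" if "k \<le> l" for k l
    using that
  proof (induction l rule: int_ge_induct)
    case (step i)
    then show ?case using sub[of "i + 1"] by auto
  qed simp
  have eq: "I k = cell k x" if "k \<le> j" for k
    using cell_eq[OF L, of x k] anti[OF that] j by auto
  have "I k \<subseteq> top_cell x" for k
  proof -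
    have "I k \<subseteq> I (min k j)" by (rule anti) simp
    then show ?thesis using eq[of "min k j"] by (auto simp: top_cell_def)
  qed
  moreover have "cell k x \<subseteq> A" for k
  proof -
    have "cell k x \<subseteq> cell (min k j) x" by (rule cell_antimono) simp
    then show ?thesis using eq[of "min k j"] I(2) by auto
  qed
  ultimately show ?thesis using I(2) unfolding top_cell_def by blast
qed

lemma infsum_A_minf_fin: "(\<Sum>\<^sub>\<infinity>A\<in>A_minf_fin L. ennreal ((Ecx f A x)\<^sup>2)) = ennreal ((tail x)\<^sup>2)"
proof (cases "emeasure lborel (top_cell x) < \<infinity>")
  case True
  have "lat_chain L (\<lambda>k. cell k x)"
    by (simp add: lat_chain_def cell_in cell_antimono)
  then have top: "top_cell x \<in> A_minf_fin L"
    using True unfolding A_minf_fin_def top_cell_def by blast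
  have "(\<Sum>\<^sub>\<infinity>A\<in>A_minf_fin L. ennreal ((Ecx f A x)\<^sup>2)) = (\<Sum>\<^sub>\<infinity>A\<in>{top_cell x}. ennreal ((Ecx f A x)\<^sup>2))"
  proof (rule infsum_cong_neutral)
    fix A assume "A \<in> A_minf_fin L - {top_cell x}"
    then have "x \<notin> A" using A_minf_fin_eq_top_cell[of A x] by auto
    then show "ennreal ((Ecx f A x)\<^sup>2) = 0" by (simp add: Ecx_def)
  qed (use top in auto)
  also have "\<dots> = ennreal ((tail x)\<^sup>2)"
    using True mem_cell[of x 0] by (auto simp: Ecx_def tail_def top_cell_def indicator_def)
  finally show ?thesis .
next
  case False
  have "ennreal ((Ecx f A x)\<^sup>2) = 0" if A: "A \<in> A_minf_fin L" for A
  proof -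
    have "emeasure lborel A < \<infinity>" using A by (auto simp: A_minf_fin_def)
    then have "x \<notin> A" using A_minf_fin_eq_top_cell[OF A, of x] False by metis
    then show ?thesis by (simp add: Ecx_def)
  qed
  then show ?thesis using False by (simp add: tail_def infsum_0)
qed

section \<open>Martingale differences and the two sums in the square function\<close>

lemma rk_eq:
  assumes "I \<in> L k" "\<And>k'. I \<in> L k' \<Longrightarrow> k' \<le> k"
  shows "rk L I = k"
  unfolding rk_def using assms by (intro Greatest_equality)

text \<open>If \<open>cell k x\<close> occurred again after generation \<open>k\<close>, it would be
  contained in \<open>cell (k + 1) x\<close>, and the two would be equal.\<close>

lemma has_rank_cell:
  assumes "cell (k + 1) x \<noteq> cell k x"
  shows "has_rank L (cell k x)" "rk L (cell k x) = k"
proof -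
  have le: "k' \<le> k" if k': "cell k x \<in> L k'" for k'
  proof (rule ccontr)
    assume "\<not> k' \<le> k"
    then have "cell k' x \<subseteq> cell (k + 1) x" by (intro cell_antimono) simp
    then show False using cell_eq[OF k' mem_cell] cell_Suc_subset[of k x] assms by simp
  qed
  show "has_rank L (cell k x)" unfolding has_rank_def using cell_in le by blast
  show "rk L (cell k x) = k" by (rule rk_eq[OF cell_in le])
qed

lemma Delta_cell:
  assumes "cell (k + 1) x \<noteq> cell k x"
  shows "Delta L f (cell k x) x = mart (k + 1) x - mart k x"
proof -
  have child: "child L (cell k x) = {J \<in> L (k + 1). J \<subseteq> cell k x}"
    by (simp add: child_def has_rank_cell(2)[OF assms])
  have fin: "finite (child L (cell k x))" unfolding child by (rule subcells_Suc(1)[OF cell_in])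
  have mem: "cell (k + 1) x \<in> child L (cell k x)"
    unfolding child using cell_in[of "k + 1" x] cell_Suc_subset[of k x] by simp
  have "(\<Sum>J\<in>child L (cell k x). Ecx f J x)
      = (\<Sum>J\<in>child L (cell k x). if J = cell (k + 1) x then mart (k + 1) x else 0)"
  proof (rule sum.cong)
    fix J assume "J \<in> child L (cell k x)"
    then have J: "J \<in> L (k + 1)" by (simp add: child)
    show "Ecx f J x = (if J = cell (k + 1) x then mart (k + 1) x else 0)"
    proof (cases "x \<in> J")
      case True
      then show ?thesis using cell_eq[OF J True] by (simp add: Ecx_def mart_def)
    next
      case False
      then have "J \<noteq> cell (k + 1) x" using mem_cell[of x "k + 1"] by metis
      then show ?thesis using False by (simp add: Ecx_def)
    qed
  qed simp
  also have "\<dots> = mart (k + 1) x" using fin mem by simp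
  finally show ?thesis
    using has_rank_cell(1)[OF assms] mem_cell[of x k] by (simp add: Delta_def Ecx_def mart_def)
qed

text \<open>An interval of rank \<open>k\<close> containing \<open>x\<close> is a cell of
  \<open>x\<close> that shrinks in generation \<open>k + 1\<close>. So here either \<open>x\<close>
  lies outside \<open>I\<close> or \<open>I\<close> has no rank, where the difference is 0 by
  convention.\<close>

lemma Delta_eq_0:
  assumes I: "\<And>k. cell (k + 1) x \<noteq> cell k x \<Longrightarrow> I \<noteq> cell k x"
  shows "Delta L f I x = 0"
proof (cases "has_rank L I")
  case True
  then obtain k where k: "I \<in> L k" "\<And>k'. I \<in> L k' \<Longrightarrow> k' \<le> k" by (auto simp: has_rank_def)
  have x: "x \<notin> I"
  proof
    assume "x \<in> I"
    then have eq: "cell k x = I" by (rule cell_eq[OF k(1)])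
    then have "cell (k + 1) x = I" using I[of k] by auto
    then have "k + 1 \<le> k" using k(2)[of "k + 1"] cell_in[of "k + 1" x] by simp
    then show False by simp
  qed
  have "(\<Sum>J\<in>child L I. Ecx f J x) = 0"
    using x by (intro sum.neutral) (auto simp: child_def Ecx_def indicator_def)
  then show ?thesis using x by (simp add: Delta_def Ecx_def)
qed (simp add: Delta_def)

text \<open>An interval may belong to many generations but counts once on the left. On the right it
  contributes only where the cell shrinks, since the increment is 0 as long as the cell persists;
  \<open>rk\<close> inverts this indexing.\<close>

lemma infsum_Delta:
  "(\<Sum>\<^sub>\<infinity>I\<in>lat_set L. ennreal ((Delta L f I x)\<^sup>2))
    = (\<Sum>\<^sub>\<infinity>k. ennreal ((mart (k + 1) x - mart k x)\<^sup>2))"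
proof -
  define A where "A = {k. cell (k + 1) x \<noteq> cell k x}"
  have "(\<Sum>\<^sub>\<infinity>I\<in>lat_set L. ennreal ((Delta L f I x)\<^sup>2))
      = (\<Sum>\<^sub>\<infinity>I\<in>(\<lambda>k. cell k x) ` A. ennreal ((Delta L f I x)\<^sup>2))"
  proof (rule infsum_cong_neutral)
    fix I assume "I \<in> lat_set L - (\<lambda>k. cell k x) ` A"
    then have "Delta L f I x = 0" by (intro Delta_eq_0) (auto simp: A_def)
    then show "ennreal ((Delta L f I x)\<^sup>2) = 0" by simp
  qed (use cell_in in \<open>auto simp: lat_set_def\<close>)
  also have "\<dots> = (\<Sum>\<^sub>\<infinity>k\<in>A. ennreal ((Delta L f (cell k x) x)\<^sup>2))"
  proof (subst infsum_reindex)
    show "inj_on (\<lambda>k. cell k x) A"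
      by (rule inj_on_inverseI[of _ "rk L"]) (simp add: A_def has_rank_cell(2))
  qed (simp add: comp_def)
  also have "\<dots> = (\<Sum>\<^sub>\<infinity>k. ennreal ((mart (k + 1) x - mart k x)\<^sup>2))"
    by (rule infsum_cong_neutral) (auto simp: A_def Delta_cell mart_def)
  finally show ?thesis .
qed

text \<open>Subtracting the initial value does not affect increments, so the quadratic variations
  over the growing windows increase with \<open>n\<close> although the starting time moves.\<close>

lemma quad_var_symmetric:
  "quad_var (incr (- int n) x) (2 * n) = (\<Sum>k\<in>{- int n..<int n}. (mart (k + 1) x - mart k x)\<^sup>2)"
  unfolding quad_var_def
  by (rule sum.reindex_bij_witness[where i = "\<lambda>k. nat (k + int n)" and j = "\<lambda>i. int i - int n"])
    (auto simp: incr_def algebra_simps)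

text \<open>The symmetric windows are cofinal among the finite sets of integers.\<close>

lemma infsum_increments:
  "(\<Sum>\<^sub>\<infinity>k. ennreal ((mart (k + 1) x - mart k x)\<^sup>2))
    = (SUP n. ennreal (quad_var (incr (- int n) x) (2 * n)))"
proof (rule antisym)
  have "(\<Sum>k\<in>F. ennreal ((mart (k + 1) x - mart k x)\<^sup>2))
      \<le> (SUP n. ennreal (quad_var (incr (- int n) x) (2 * n)))" if F: "finite F" for F
  proof -
    obtain n :: nat where n: "\<forall>k\<in>F. nat \<bar>k\<bar> < n"
      using finite_nat_set_iff_bounded[of "(\<lambda>k. nat \<bar>k\<bar>) ` F"] F by auto
    have "F \<subseteq> {- int n..<int n}"
    proof
      fix k assume "k \<in> F"
      then have "nat \<bar>k\<bar> < n" using n by blast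
      then show "k \<in> {- int n..<int n}" by auto
    qed
    then have "(\<Sum>k\<in>F. (mart (k + 1) x - mart k x)\<^sup>2) \<le> quad_var (incr (- int n) x) (2 * n)"
      unfolding quad_var_symmetric by (intro sum_mono2) auto
    then have "(\<Sum>k\<in>F. ennreal ((mart (k + 1) x - mart k x)\<^sup>2))
        \<le> ennreal (quad_var (incr (- int n) x) (2 * n))"
      by (simp add: ennreal_leI sum_ennreal)
    also have "\<dots> \<le> (SUP n. ennreal (quad_var (incr (- int n) x) (2 * n)))"
      by (rule SUP_upper) simp
    finally show ?thesis .
  qed
  then show "(\<Sum>\<^sub>\<infinity>k. ennreal ((mart (k + 1) x - mart k x)\<^sup>2))
      \<le> (SUP n. ennreal (quad_var (incr (- int n) x) (2 * n)))"
    by (subst nonneg_infsum_complete) (auto intro!: SUP_least)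
  show "(SUP n. ennreal (quad_var (incr (- int n) x) (2 * n)))
      \<le> (\<Sum>\<^sub>\<infinity>k. ennreal ((mart (k + 1) x - mart k x)\<^sup>2))"
  proof (rule SUP_least)
    fix n
    have "ennreal (quad_var (incr (- int n) x) (2 * n))
        = (\<Sum>k\<in>{- int n..<int n}. ennreal ((mart (k + 1) x - mart k x)\<^sup>2))"
      by (simp add: quad_var_symmetric sum_ennreal)
    then show "ennreal (quad_var (incr (- int n) x) (2 * n))
        \<le> (\<Sum>\<^sub>\<infinity>k. ennreal ((mart (k + 1) x - mart k x)\<^sup>2))"
      by (subst nonneg_infsum_complete) (auto intro!: SUP_upper)
  qed
qed

section \<open>Comparison with the functionals on finite time windows\<close>

lemma sqf_eq:
  "sqf L f x = sqrt_enn ((SUP n. ennreal (quad_var (incr (- int n) x) (2 * n))) + ennreal ((tail x)\<^sup>2))"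
  by (simp add: sqf_def infsum_Delta infsum_increments infsum_A_minf_fin)

lemma sqf_le:
  "sqf L f x \<le> (SUP n. ennreal (sqrt (quad_var (incr (- int n) x) (2 * n)))) + ennreal \<bar>tail x\<bar>"
proof -
  have "sqf L f x \<le> sqrt_enn (SUP n. ennreal (quad_var (incr (- int n) x) (2 * n)))
      + sqrt_enn (ennreal ((tail x)\<^sup>2))"
    unfolding sqf_eq by (rule sqrt_enn_add_le)
  also have "\<dots> \<le> (SUP n. ennreal (sqrt (quad_var (incr (- int n) x) (2 * n)))) + ennreal \<bar>tail x\<bar>"
    by (intro add_mono sqrt_enn_SUP_le quad_var_nonneg) (simp add: sqrt_enn_ennreal)
  finally show ?thesis .
qed

lemma quad_var_le_sqf: "ennreal (sqrt (quad_var (incr (- int n) x) (2 * n))) \<le> sqf L f x"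
proof -
  have "ennreal (quad_var (incr (- int n) x) (2 * n))
      \<le> (SUP n. ennreal (quad_var (incr (- int n) x) (2 * n))) + ennreal ((tail x)\<^sup>2)"
    by (intro add_increasing2 SUP_upper) auto
  from sqrt_enn_mono[OF this] show ?thesis
    unfolding sqf_eq by (simp add: sqrt_enn_ennreal quad_var_nonneg)
qed

lemma tail_le_sqf: "ennreal \<bar>tail x\<bar> \<le> sqf L f x"
proof -
  have "ennreal ((tail x)\<^sup>2)
      \<le> (SUP n. ennreal (quad_var (incr (- int n) x) (2 * n))) + ennreal ((tail x)\<^sup>2)"
    by (intro add_increasing) auto
  from sqrt_enn_mono[OF this] show ?thesis
    unfolding sqf_eq by (simp add: sqrt_enn_ennreal)
qed

text \<open>As \<open>n\<close> grows, the path started at \<open>- int n\<close> sees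
  \<open>mart k x\<close> minus a value tending to \<open>tail x\<close>. The moving initial value
  prevents monotonicity in \<open>n\<close>, hence the lower limit; adding \<open>tail\<close>
  undoes the subtraction.\<close>

lemma maxf_le_liminf:
  "maxf L f x \<le> liminf (\<lambda>n. ennreal (running_max (incr (- int n) x) (2 * n))) + ennreal \<bar>tail x\<bar>"
  unfolding maxf_eq
proof (rule SUP_least)
  fix k
  have "(\<lambda>n. ennreal \<bar>mart k x - mart (- int n) x\<bar>) \<longlonglongrightarrow> ennreal \<bar>mart k x - tail x\<bar>"
    by (intro tendsto_ennrealI tendsto_rabs tendsto_diff tendsto_const tendsto_tail)
  then have "ennreal \<bar>mart k x - tail x\<bar> = liminf (\<lambda>n. ennreal \<bar>mart k x - mart (- int n) x\<bar>)"
    by (intro lim_imp_Liminf[symmetric]) auto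
  also have "\<dots> \<le> liminf (\<lambda>n. ennreal (running_max (incr (- int n) x) (2 * n)))"
  proof (rule Liminf_mono)
    have "ennreal \<bar>mart k x - mart (- int n) x\<bar> \<le> ennreal (running_max (incr (- int n) x) (2 * n))"
      \<comment> \<open>This places generation \<open>k\<close> at a time between 0 and
        \<open>2 * n\<close> of the path.\<close>
      if "nat \<bar>k\<bar> \<le> n" for n
    proof -
      have "\<bar>incr (- int n) x (nat (k + int n))\<bar> \<le> running_max (incr (- int n) x) (2 * n)"
        using that by (intro abs_le_running_max) linarith
      moreover have "int (nat (k + int n)) = k + int n" using that by linarith
      ultimately show ?thesis by (simp add: incr_def ennreal_leI)
    qed
    then show "\<forall>\<^sub>F n in sequentially. ennreal \<bar>mart k x - mart (- int n) x\<bar>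
        \<le> ennreal (running_max (incr (- int n) x) (2 * n))"
      unfolding eventually_sequentially by blast
  qed
  finally have "ennreal \<bar>mart k x - tail x\<bar> + ennreal \<bar>tail x\<bar>
      \<le> liminf (\<lambda>n. ennreal (running_max (incr (- int n) x) (2 * n))) + ennreal \<bar>tail x\<bar>"
    by (rule add_right_mono)
  moreover have "ennreal \<bar>mart k x\<bar> \<le> ennreal \<bar>mart k x - tail x\<bar> + ennreal \<bar>tail x\<bar>"
    by (simp add: ennreal_leI flip: ennreal_plus)
  ultimately show "ennreal \<bar>mart k x\<bar>
      \<le> liminf (\<lambda>n. ennreal (running_max (incr (- int n) x) (2 * n))) + ennreal \<bar>tail x\<bar>"
    by (rule order_trans[rotated])
qed

section \<open>Passage to unbounded time\<close>

lemma nn_integral_sqf_le: "(\<integral>\<^sup>+x. sqf L f x \<partial>lborel) \<le> 9 * (\<integral>\<^sup>+x. maxf L f x \<partial>lborel)"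
proof -
  let ?Q = "\<lambda>n x. ennreal (sqrt (quad_var (incr (- int n) x) (2 * n)))"
  have "incseq ?Q"
  proof (rule incseq_SucI, rule le_funI)
    fix n x
    show "?Q n x \<le> ?Q (Suc n) x"
      unfolding quad_var_symmetric by (intro ennreal_leI real_sqrt_le_mono sum_mono2) auto
  qed
  then have SUP: "(\<integral>\<^sup>+x. (SUP n. ?Q n x) \<partial>lborel) = (SUP n. \<integral>\<^sup>+x. ?Q n x \<partial>lborel)"
    by (intro nn_integral_monotone_convergence_SUP) simp_all
  \<comment> \<open>The 8 is the 4 of the finite-time inequality times the 2 of
    \<open>running_max_le_maxf\<close>; the tail will add 1.\<close>
  have "(\<integral>\<^sup>+x. ?Q n x \<partial>lborel) \<le> 8 * (\<integral>\<^sup>+x. maxf L f x \<partial>lborel)" for n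
  proof -
    have "(\<integral>\<^sup>+x. ennreal (running_max (incr (- int n) x) (2 * n)) \<partial>lborel)
        \<le> (\<integral>\<^sup>+x. 2 * maxf L f x \<partial>lborel)"
      by (intro nn_integral_mono running_max_le_maxf)
    also have "\<dots> = 2 * (\<integral>\<^sup>+x. maxf L f x \<partial>lborel)" by (intro nn_integral_cmult) simp
    finally have "4 * (\<integral>\<^sup>+x. ennreal (running_max (incr (- int n) x) (2 * n)) \<partial>lborel)
        \<le> 4 * (2 * (\<integral>\<^sup>+x. maxf L f x \<partial>lborel))" by (rule mult_left_mono) simp
    then show ?thesis
      using nn_integral_quad_var_le[of "- int n" "2 * n"] by (simp add: mult.assoc[symmetric])
  qed
  then have "(\<integral>\<^sup>+x. (SUP n. ?Q n x) \<partial>lborel) \<le> 8 * (\<integral>\<^sup>+x. maxf L f x \<partial>lborel)"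
    unfolding SUP by (rule SUP_least)
  moreover have "(\<integral>\<^sup>+x. ennreal \<bar>tail x\<bar> \<partial>lborel) \<le> (\<integral>\<^sup>+x. maxf L f x \<partial>lborel)"
    by (intro nn_integral_mono tail_le_maxf)
  ultimately have "(\<integral>\<^sup>+x. (SUP n. ?Q n x) \<partial>lborel) + (\<integral>\<^sup>+x. ennreal \<bar>tail x\<bar> \<partial>lborel)
      \<le> 8 * (\<integral>\<^sup>+x. maxf L f x \<partial>lborel) + (\<integral>\<^sup>+x. maxf L f x \<partial>lborel)"
    by (rule add_mono)
  moreover have "(\<integral>\<^sup>+x. sqf L f x \<partial>lborel) \<le> (\<integral>\<^sup>+x. (SUP n. ?Q n x) + ennreal \<bar>tail x\<bar> \<partial>lborel)"
    by (intro nn_integral_mono sqf_le)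
  moreover have "(\<integral>\<^sup>+x. (SUP n. ?Q n x) + ennreal \<bar>tail x\<bar> \<partial>lborel)
      = (\<integral>\<^sup>+x. (SUP n. ?Q n x) \<partial>lborel) + (\<integral>\<^sup>+x. ennreal \<bar>tail x\<bar> \<partial>lborel)"
    by (intro nn_integral_add) simp_all
  moreover have "8 * z + z = 9 * z" for z :: ennreal
    using distrib_right[of 8 1 z] by simp
  ultimately show ?thesis by simp
qed

lemma nn_integral_maxf_le: "(\<integral>\<^sup>+x. maxf L f x \<partial>lborel) \<le> 13 * (\<integral>\<^sup>+x. sqf L f x \<partial>lborel)"
proof -
  let ?M = "\<lambda>n x. ennreal (running_max (incr (- int n) x) (2 * n))"
  have "(\<integral>\<^sup>+x. ?M n x \<partial>lborel) \<le> 12 * (\<integral>\<^sup>+x. sqf L f x \<partial>lborel)" for n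
  proof -
    have "12 * (\<integral>\<^sup>+x. ennreal (sqrt (quad_var (incr (- int n) x) (2 * n))) \<partial>lborel)
        \<le> 12 * (\<integral>\<^sup>+x. sqf L f x \<partial>lborel)"
      by (intro mult_left_mono nn_integral_mono quad_var_le_sqf) simp
    then show ?thesis using nn_integral_running_max_le[of "- int n" "2 * n"] by (rule order_trans[rotated])
  qed
  then have "liminf (\<lambda>n. \<integral>\<^sup>+x. ?M n x \<partial>lborel) \<le> liminf (\<lambda>n::nat. 12 * (\<integral>\<^sup>+x. sqf L f x \<partial>lborel))"
    by (intro Liminf_mono always_eventually allI)
  then have "liminf (\<lambda>n. \<integral>\<^sup>+x. ?M n x \<partial>lborel) \<le> 12 * (\<integral>\<^sup>+x. sqf L f x \<partial>lborel)"
    by (simp add: Liminf_const)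
  \<comment> \<open>Fatou's lemma transfers the uniform bound 12; the tail again adds 1.\<close>
  moreover have "(\<integral>\<^sup>+x. liminf (\<lambda>n. ?M n x) \<partial>lborel) \<le> liminf (\<lambda>n. \<integral>\<^sup>+x. ?M n x \<partial>lborel)"
    by (intro nn_integral_liminf) simp
  ultimately have "(\<integral>\<^sup>+x. liminf (\<lambda>n. ?M n x) \<partial>lborel) \<le> 12 * (\<integral>\<^sup>+x. sqf L f x \<partial>lborel)"
    by (rule order_trans[rotated])
  moreover have "(\<integral>\<^sup>+x. ennreal \<bar>tail x\<bar> \<partial>lborel) \<le> (\<integral>\<^sup>+x. sqf L f x \<partial>lborel)"
    by (intro nn_integral_mono tail_le_sqf)
  ultimately have "(\<integral>\<^sup>+x. liminf (\<lambda>n. ?M n x) \<partial>lborel) + (\<integral>\<^sup>+x. ennreal \<bar>tail x\<bar> \<partial>lborel)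
      \<le> 12 * (\<integral>\<^sup>+x. sqf L f x \<partial>lborel) + (\<integral>\<^sup>+x. sqf L f x \<partial>lborel)"
    by (rule add_mono)
  moreover have "(\<integral>\<^sup>+x. maxf L f x \<partial>lborel)
      \<le> (\<integral>\<^sup>+x. liminf (\<lambda>n. ?M n x) + ennreal \<bar>tail x\<bar> \<partial>lborel)"
    by (intro nn_integral_mono maxf_le_liminf)
  moreover have "(\<integral>\<^sup>+x. liminf (\<lambda>n. ?M n x) + ennreal \<bar>tail x\<bar> \<partial>lborel)
      = (\<integral>\<^sup>+x. liminf (\<lambda>n. ?M n x) \<partial>lborel) + (\<integral>\<^sup>+x. ennreal \<bar>tail x\<bar> \<partial>lborel)"
    by (intro nn_integral_add) simp_all
  moreover have "12 * z + z = 13 * z" for z :: ennreal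
    using distrib_right[of 12 1 z] by simp
  ultimately show ?thesis by simp
qed

end

theorem theorem1:
  shows "\<exists>c C::real. 0 < c \<and> c \<le> C \<and>
    (\<forall>L f. lattice L \<and> A_inf_measurable L f \<and> integrable lborel f \<longrightarrow>
       ennreal c * (\<integral>\<^sup>+ x. sqf L f x \<partial>lborel) \<le> (\<integral>\<^sup>+ x. maxf L f x \<partial>lborel) \<and>
       (\<integral>\<^sup>+ x. maxf L f x \<partial>lborel) \<le> ennreal C * (\<integral>\<^sup>+ x. sqf L f x \<partial>lborel))"
proof (rule exI[of _ "1 / 9"], rule exI[of _ 13], intro conjI allI impI)
  fix L f
  assume "lattice L \<and> A_inf_measurable L f \<and> integrable lborel f"
  then interpret lattice_function L f by unfold_locales auto
  have "ennreal (1 / 9) * (\<integral>\<^sup>+ x. sqf L f x \<partial>lborel)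
      \<le> ennreal (1 / 9) * (9 * (\<integral>\<^sup>+ x. maxf L f x \<partial>lborel))"
    by (intro mult_left_mono nn_integral_sqf_le) simp
  also have "\<dots> = (\<integral>\<^sup>+ x. maxf L f x \<partial>lborel)"
  proof -
    have "ennreal (1 / 9) * 9 = 1"
      using ennreal_mult[of "1 / 9" 9] by simp
    then show ?thesis by (simp flip: mult.assoc)
  qed
  finally show "ennreal (1 / 9) * (\<integral>\<^sup>+ x. sqf L f x \<partial>lborel) \<le> (\<integral>\<^sup>+ x. maxf L f x \<partial>lborel)" .
  show "(\<integral>\<^sup>+ x. maxf L f x \<partial>lborel) \<le> ennreal 13 * (\<integral>\<^sup>+ x. sqf L f x \<partial>lborel)"
    using nn_integral_maxf_le by simp
qed simp_all

end
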